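(* Let $k\in\mathbb{Z}$, let $n\ge 0$ be an integer, and let $\lambda\in\mathbb{C}$ be nonzero. Then $$\beta_{n,\lambda}^{(k)}=\sum_{l=0}^{n}\sum_{m=0}^{l}\frac{(-1)^{m+l}\,m!}{(m+1)^{k}}S_{2}(l,m)S_{1}(n,l)\lambda^{n-l}.$$
   Context: For $k\in\mathbb{Z}$, $\mathrm{Li}_k(u)=\sum_{n=1}^{\infty}\frac{u^n}{n^k}$. For nonzero $\lambda$, the fully degenerate poly-Bernoulli numbers $\beta_{n,\lambda}^{(k)}$ are defined by the generating function (identity of formal power series in $t$) $$\frac{\mathrm{Li}_{k}\left(1-(1+\lambda t)^{-1/\lambda}\right)}{1-(1+\lambda t)^{-1/\lambda}}=\sum_{n=0}^{\infty}\beta_{n,\lambda}^{(k)}\frac{t^{n}}{n!},$$ where $(1+\lambda t)^{a}=\sum_{j\ge0}(a)_j\lambda^j\frac{t^j}{j!}$, $(a)_j=a(a-1)\cdots(a-j+1)$ with $(a)_0=1$, and $\mathrm{Li}_k(u)/u$ denotes the series $\sum_{m\ge 0}u^m/(m+1)^k$. $S_1(n,l)$ denotes the (signed) Stirling numbers of the first kind, $(x)_n=\sum_{l=0}^n S_1(n,l)x^l$, and $S_2(n,l)$ the Stirling numbers of the second kind, $\frac{(e^t-1)^l}{l!}=\sum_{n\ge l}S_2(n,l)\frac{t^n}{n!}$. *)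

theory Defs
  imports
    Complex_Main
    "HOL-Computational_Algebra.Computational_Algebra"
    "HOL-Combinatorics.Stirling"
begin

definition falling_factorial :: "'a::comm_ring_1 \<Rightarrow> nat \<Rightarrow> 'a" where
  "falling_factorial x n = (\<Prod>i<n. x - of_nat i)"

text \<open>
  Signed Stirling numbers of the first kind: the coefficients of the polynomial
  \<open>(x)\<^sub>n\<close>, the falling factorial of the indeterminate \<open>[:0, 1:]\<close>.
  (The library's \<^const>\<open>stirling\<close> is the unsigned version.)
\<close>

definition stirling1 :: "nat \<Rightarrow> nat \<Rightarrow> int" where
  "stirling1 n l = coeff (falling_factorial [:0, 1:] n) l"

text \<open>The series \<open>(1 + lam \<cdot> t)\<^sup>a\<close> in \<open>t\<close>.\<close>

definition fps_degenerate_power :: "complex \<Rightarrow> complex \<Rightarrow> complex fps" where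
  "fps_degenerate_power lam a = Abs_fps (\<lambda>j. falling_factorial a j * lam ^ j / fact j)"

definition fps_polylog :: "int \<Rightarrow> complex fps" where
  "fps_polylog k = Abs_fps (\<lambda>n. if n = 0 then 0 else 1 / of_nat n powi k)"

text \<open>The series \<open>Li\<^sub>k(u) / u\<close>; see \<open>fps_polylog_eq\<close> below.\<close>

definition fps_polylog_quotient :: "int \<Rightarrow> complex fps" where
  "fps_polylog_quotient k = Abs_fps (\<lambda>m. 1 / of_nat (m + 1) powi k)"

text \<open>
  The composition is a substitution of formal power series, since
  \<open>1 - (1 + lam \<cdot> t)\<^bsup>-1/lam\<^esup>\<close> has constant term 0.
\<close>

definition fully_degenerate_poly_bernoulli :: "int \<Rightarrow> complex \<Rightarrow> nat \<Rightarrow> complex" where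
  "fully_degenerate_poly_bernoulli k lam n =
     fact n * fps_nth (fps_compose (fps_polylog_quotient k)
                         (1 - fps_degenerate_power lam (- 1 / lam))) n"


lemma fps_polylog_eq: "fps_polylog k = fps_X * fps_polylog_quotient k"
  by (rule fps_ext) (auto simp: fps_polylog_def fps_polylog_quotient_def)

lemma fps_degenerate_power_nth_0: "fps_nth (fps_degenerate_power lam a) 0 = 1"
  by (simp add: fps_degenerate_power_def falling_factorial_def)

lemma fully_degenerate_poly_bernoulli_gf:
  "fps_compose (fps_polylog_quotient k) (1 - fps_degenerate_power lam (- 1 / lam)) =
     Abs_fps (\<lambda>n. fully_degenerate_poly_bernoulli k lam n / fact n)"
  by (rule fps_ext) (simp add: fully_degenerate_poly_bernoulli_def)

lemma fully_degenerate_poly_bernoulli_quotient: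
  assumes "lam \<noteq> 0"
  defines "u \<equiv> 1 - fps_degenerate_power lam (- 1 / lam)"
  shows "fps_compose (fps_polylog k) u / u =
           Abs_fps (\<lambda>n. fully_degenerate_poly_bernoulli k lam n / fact n)"
proof -
  have u0: "fps_nth u 0 = 0"
    by (simp add: u_def fps_degenerate_power_nth_0)
  have "fps_nth u 1 = 1"
    using assms(1) by (simp add: u_def fps_degenerate_power_def falling_factorial_def)
  then have "u \<noteq> 0" by auto
  moreover have "fps_compose (fps_polylog k) u = u * fps_compose (fps_polylog_quotient k) u"
    by (simp add: fps_polylog_eq fps_compose_mult_distrib[OF u0] fps_X_fps_compose_startby0[OF u0])
  ultimately show ?thesis
    using fully_degenerate_poly_bernoulli_gf[of k lam] unfolding u_def[symmetric] by simp
qed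

lemma falling_factorial_eq_sum_stirling1:
  fixes x :: int
  shows "falling_factorial x n = (\<Sum>l=0..n. stirling1 n l * x ^ l)"
proof -
  define p where "p = (falling_factorial [:0, 1:] n :: int poly)"
  have "poly p x = falling_factorial x n"
    by (simp add: p_def falling_factorial_def poly_prod)
  moreover have deg: "degree p \<le> n"
  proof -
    have "degree p \<le> (\<Sum>i<n. degree ([:0, 1:] - of_nat i :: int poly))"
      unfolding p_def falling_factorial_def
      using degree_prod_sum_le[of "{..<n}" "\<lambda>i. [:0, 1:] - of_nat i :: int poly"] by (simp add: comp_def)
    also have "\<dots> \<le> (\<Sum>i<n. 1)"
      by (intro sum_mono) (simp add: of_nat_poly)
    finally show ?thesis by simp
  qed
  have "poly p x = (\<Sum>l=0..n. coeff p l * x ^ l)"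
    unfolding poly_altdef atLeast0AtMost using deg
    by (intro sum.mono_neutral_left) (auto simp: coeff_eq_0)
  ultimately show ?thesis
    by (simp add: stirling1_def p_def)
qed

text \<open>The library's recursively defined \<^const>\<open>Stirling\<close> has the usual generating function.\<close>

lemma Stirling_gf:
  "(fps_exp 1 - 1) ^ l / fps_const (fact l) =
     Abs_fps (\<lambda>n. of_nat (Stirling n l) / fact n :: complex)"
proof -
  define E where "E = (\<lambda>l. fps_const (1 / fact l) * (fps_exp 1 - 1) ^ l :: complex fps)"
  have deriv_E: "fps_deriv (E (Suc l)) = E l + of_nat (Suc l) * E (Suc l)" for l
  proof -
    have fact_eq: "fps_const (1 / fact (Suc l)) * of_nat (Suc l) = (fps_const (1 / fact l) :: complex fps)"
      unfolding fps_of_nat[symmetric] fps_const_mult by (simp del: of_nat_Suc)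
    have "fps_deriv ((fps_exp 1 - 1 :: complex fps) ^ Suc l) =
        of_nat (Suc l) * ((fps_exp 1 - 1) ^ l * fps_exp 1)"
      by (subst fps_deriv_power') (simp add: mult_ac del: of_nat_Suc)
    then have "fps_deriv (E (Suc l)) =
        fps_const (1 / fact (Suc l)) * of_nat (Suc l) * ((fps_exp 1 - 1) ^ l * fps_exp 1)"
      unfolding E_def fps_deriv_mult_const_left by (simp only: mult.assoc)
    also note fact_eq
    also have "fps_const (1 / fact l) * ((fps_exp 1 - 1) ^ l * fps_exp 1) =
        E l + fps_const (1 / fact l) * (fps_exp 1 - 1) ^ Suc l"
      by (simp add: E_def algebra_simps)
    also have "fps_const (1 / fact l) * (fps_exp 1 - 1) ^ Suc l = of_nat (Suc l) * E (Suc l)"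
      unfolding E_def fact_eq[symmetric] by (simp only: mult_ac)
    finally show ?thesis .
  qed
  have "fact n * fps_nth (E l) n = of_nat (Stirling n l)" for n l
  proof (induction n l rule: Stirling.induct)
    case (4 n l)
    have "of_nat (Suc n) * fps_nth (E (Suc l)) (Suc n) =
        fps_nth (E l) n + of_nat (Suc l) * fps_nth (E (Suc l)) n"
      using arg_cong[OF deriv_E[of l], of "\<lambda>f. fps_nth f n"]
      by (simp add: fps_of_nat[symmetric] del: of_nat_Suc)
    then have "fact (Suc n) * fps_nth (E (Suc l)) (Suc n) =
        fact n * (fps_nth (E l) n + of_nat (Suc l) * fps_nth (E (Suc l)) n)"
      by (metis fact_Suc mult.assoc mult.commute of_nat_fact of_nat_mult)
    with 4 show ?case
      by (simp add: algebra_simps)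
  qed (simp_all add: E_def)
  then have "E l = Abs_fps (\<lambda>n. of_nat (Stirling n l) / fact n)"
    by (intro fps_ext) (simp add: field_simps)
  moreover have "(fps_exp 1 - 1) ^ l / fps_const (fact l) = E l"
    by (simp add: E_def fps_divide_unit fps_const_inverse inverse_eq_divide mult.commute)
  ultimately show ?thesis by simp
qed

end

theory Submission
  imports Defs
begin

text \<open>
  Put \<open>u = 1 - (1 + \<lambda>t)\<^bsup>-1/\<lambda>\<^esup>\<close>. By the binomial theorem \<open>u\<^sup>m\<close> is an alternating sum of the series
  \<open>(1 + \<lambda>t)\<^bsup>-j/\<lambda>\<^esup>\<close>, whose coefficients \<open>(-j/\<lambda>)\<^sub>n \<lambda>\<^sup>n / n!\<close> expand into powers of \<open>j\<close> with the Stirling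
  numbers of the first kind. Summing these powers of \<open>j\<close> against the alternating binomial
  coefficients yields the Stirling numbers of the second kind.
\<close>

lemma stirling1_0: "stirling1 0 l = (if l = 0 then 1 else 0)"
  by (simp add: stirling1_def falling_factorial_def)

text \<open>Compare coefficients in \<open>(x)_(n+1) = x (x)_n - n (x)_n\<close>; the case
  \<open>l = 0\<close> is split off because multiplication by \<open>x\<close> leaves no constant
  term.\<close>

lemma stirling1_Suc:
  "stirling1 (Suc n) l = (if l = 0 then 0 else stirling1 n (l - 1)) - int n * stirling1 n l"
proof -
  have "falling_factorial [:0, 1:] (Suc n) =
      pCons 0 (falling_factorial [:0, 1:] n) - smult (int n) (falling_factorial [:0, 1:] n)"
    by (simp add: falling_factorial_def of_nat_poly algebra_simps)
  then show ?thesis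
    by (simp add: stirling1_def coeff_pCons split: nat.splits)
qed

lemma stirling1_less: "n < l \<Longrightarrow> stirling1 n l = 0"
  by (induction n arbitrary: l) (auto simp: stirling1_0 stirling1_Suc)

text \<open>The expansion is needed at complex arguments \<open>x / lam\<close>. Induction with
  \<open>stirling1_Suc\<close> carries the integer coefficients into any commutative ring.\<close>

lemma falling_factorial_eq_sum_of_int_stirling1:
  fixes x :: "'a::comm_ring_1"
  shows "falling_factorial x n = (\<Sum>l\<le>n. of_int (stirling1 n l) * x ^ l)"
proof (induction n)
  case 0
  then show ?case by (simp add: falling_factorial_def stirling1_0)
next
  case (Suc n)
  have "(\<Sum>l\<le>Suc n. of_int (stirling1 (Suc n) l) * x ^ l) =
      (\<Sum>l\<le>Suc n. of_int (if l = 0 then 0 else stirling1 n (l - 1)) * x ^ l) -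
      of_nat n * (\<Sum>l\<le>Suc n. of_int (stirling1 n l) * x ^ l)"
    by (simp only: stirling1_Suc of_int_diff of_int_mult of_int_of_nat_eq left_diff_distrib
        sum_subtractf sum_distrib_left mult.assoc)
  also have "(\<Sum>l\<le>Suc n. of_int (if l = 0 then 0 else stirling1 n (l - 1)) * x ^ l) =
      x * falling_factorial x n"
    by (subst sum.atMost_Suc_shift) (simp add: Suc.IH sum_distrib_left mult_ac)
  also have "(\<Sum>l\<le>Suc n. of_int (stirling1 n l) * x ^ l) = falling_factorial x n"
    by (simp add: Suc.IH stirling1_less)
  finally show ?case
    by (simp add: falling_factorial_def algebra_simps)
qed

text \<open>This makes the exponent law of \<open>fps_binomial\<close> available for powers of the
  degenerate series.\<close>

lemma fps_degenerate_power_eq_binomial: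
  "fps_degenerate_power lam a = fps_binomial a oo (fps_const lam * fps_X)"
  by (rule fps_ext)
     (simp add: fps_degenerate_power_def falling_factorial_def gbinomial_prod_rev
        atLeast0LessThan fps_compose_linear)

lemma fps_degenerate_power_power:
  "fps_degenerate_power lam a ^ j = fps_degenerate_power lam (of_nat j * a)"
  by (simp add: fps_degenerate_power_eq_binomial fps_compose_power fps_binomial_power)

lemma one_minus_power:
  fixes x :: "'a::comm_ring_1"
  shows "(1 - x) ^ m = (\<Sum>j\<le>m. of_nat (m choose j) * (- 1) ^ j * x ^ j)"
  using binomial_ring[of "- x" 1 m] by (simp add: power_minus[of x] mult.assoc)

text \<open>Both sides are \<open>l!\<close> times the coefficient of \<open>t^l\<close> in
  \<open>(1 - e^t)^m\<close>: the left by \<open>Stirling_gf\<close>, the right by expanding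
  binomially into the series \<open>e^(jt)\<close>.\<close>

lemma fact_mult_Stirling:
  "(-1) ^ m * fact m * of_nat (Stirling l m) =
     (\<Sum>j\<le>m. of_nat (m choose j) * (-1) ^ j * of_nat j ^ l :: complex)"
proof -
  define E :: "complex fps" where "E = fps_exp 1 - 1"
  have "E ^ m = fps_const (fact m) * (E ^ m / fps_const (fact m))"
    by (simp add: fps_divide_unit mult.left_commute inverse_mult_eq_1' mult.assoc)
  also have "\<dots> = fps_const (fact m) * Abs_fps (\<lambda>n. of_nat (Stirling n m) / fact n)"
    by (simp only: E_def Stirling_gf)
  finally have "(-1) ^ m * fact m * of_nat (Stirling l m) = fact l * ((-1) ^ m * fps_nth (E ^ m) l)"
    by simp
  also have "(-1) ^ m * fps_nth (E ^ m) l = fps_nth (fps_const ((-1) ^ m) * E ^ m) l"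
    by simp
  also have "fps_const ((-1) ^ m) * E ^ m = (1 - fps_exp 1) ^ m"
    by (simp add: E_def fps_const_power[symmetric] power_mult_distrib[symmetric]
        fps_const_neg[symmetric] del: fps_const_power fps_const_neg)
  also have "\<dots> = (\<Sum>j\<le>m. fps_const (of_nat (m choose j) * (-1) ^ j) * fps_exp (of_nat j))"
    by (simp add: one_minus_power fps_exp_power_mult fps_of_nat[symmetric]
        fps_const_mult[symmetric] fps_const_power[symmetric] fps_const_neg[symmetric]
        del: fps_const_mult fps_const_power fps_const_neg)
  also have "fact l * fps_nth \<dots> l = (\<Sum>j\<le>m. of_nat (m choose j) * (-1) ^ j * of_nat j ^ l)"
    by (simp add: fps_sum_nth sum_distrib_left)
  finally show ?thesis .
qed

text \<open>Writing the exponent as \<open>x / lam\<close> lets the factor \<open>lam^n\<close> of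
  the coefficient absorb the denominators \<open>lam^l\<close>. It is applied with
  \<open>x = -j\<close>.\<close>

lemma fact_mult_fps_degenerate_power_nth:
  assumes "lam \<noteq> 0"
  shows "fact n * fps_nth (fps_degenerate_power lam (x / lam)) n =
    (\<Sum>l\<le>n. of_int (stirling1 n l) * x ^ l * lam ^ (n - l))"
proof -
  have "fact n * fps_nth (fps_degenerate_power lam (x / lam)) n =
      (\<Sum>l\<le>n. of_int (stirling1 n l) * (x / lam) ^ l * lam ^ n)"
    by (simp add: fps_degenerate_power_def falling_factorial_eq_sum_of_int_stirling1
        sum_distrib_right)
  also have "\<dots> = (\<Sum>l\<le>n. of_int (stirling1 n l) * x ^ l * lam ^ (n - l))"
    using assms by (intro sum.cong) (auto simp: power_divide power_diff)
  finally show ?thesis .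
qed

lemma fact_mult_one_minus_fps_degenerate_power_nth:
  assumes "lam \<noteq> 0"
  shows "fact n * fps_nth ((1 - fps_degenerate_power lam (- 1 / lam)) ^ m) n =
    (\<Sum>l\<le>n. (-1) ^ (m + l) * fact m * of_nat (Stirling l m) * of_int (stirling1 n l) * lam ^ (n - l))"
proof -
  have "(1 - fps_degenerate_power lam (- 1 / lam)) ^ m =
      (\<Sum>j\<le>m. fps_const (of_nat (m choose j) * (-1) ^ j) * fps_degenerate_power lam (- of_nat j / lam))"
    by (simp add: one_minus_power fps_degenerate_power_power fps_of_nat[symmetric]
        fps_const_mult[symmetric] fps_const_power[symmetric] fps_const_neg[symmetric]
        del: fps_const_mult fps_const_power fps_const_neg)
  then have "fact n * fps_nth ((1 - fps_degenerate_power lam (- 1 / lam)) ^ m) n =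
      (\<Sum>j\<le>m. of_nat (m choose j) * (-1) ^ j *
        (fact n * fps_nth (fps_degenerate_power lam (- of_nat j / lam)) n))"
    by (simp add: fps_sum_nth sum_distrib_left mult_ac)
  also have "\<dots> = (\<Sum>j\<le>m. \<Sum>l\<le>n. of_nat (m choose j) * (-1) ^ j *
      (of_int (stirling1 n l) * (- of_nat j) ^ l * lam ^ (n - l)))"
    by (simp only: fact_mult_fps_degenerate_power_nth[OF assms] sum_distrib_left)
  also have "\<dots> = (\<Sum>l\<le>n. \<Sum>j\<le>m. of_nat (m choose j) * (-1) ^ j *
      (of_int (stirling1 n l) * (- of_nat j) ^ l * lam ^ (n - l)))"
    by (rule sum.swap)
  \<comment> \<open>The sign \<open>(-1)^l\<close> comes from \<open>(-j)^l\<close>; at fixed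
    \<open>l\<close> the remaining sum over \<open>j\<close> is the one in
    \<open>fact_mult_Stirling\<close>, which supplies the sign \<open>(-1)^m\<close>.\<close>
  also have "\<dots> = (\<Sum>l\<le>n. (-1) ^ l * of_int (stirling1 n l) * lam ^ (n - l) *
      (\<Sum>j\<le>m. of_nat (m choose j) * (-1) ^ j * of_nat j ^ l))"
    by (simp add: sum_distrib_left power_minus[of "of_nat _"] mult_ac)
  finally show ?thesis
    unfolding fact_mult_Stirling[symmetric] by (simp add: power_add mult_ac)
qed

theorem theorem4:
  fixes k :: int and n :: nat and lam :: complex
  assumes "lam \<noteq> 0"
  shows "fully_degenerate_poly_bernoulli k lam n =
    (\<Sum>l=0..n. \<Sum>m=0..l.
      (-1) ^ (m + l) * fact m / of_nat (m + 1) powi k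
        * of_nat (Stirling l m) * of_int (stirling1 n l) * lam ^ (n - l))"
proof -
  define f :: "nat \<Rightarrow> nat \<Rightarrow> complex" where
    "f l m = (-1) ^ (m + l) * fact m / of_nat (m + 1) powi k
        * of_nat (Stirling l m) * of_int (stirling1 n l) * lam ^ (n - l)" for l m
  \<comment> \<open>Stopping at \<open>m = n\<close> loses nothing: the inner series has constant
    term 0, so its higher powers have no term in \<open>t^n\<close>.\<close>
  have "fully_degenerate_poly_bernoulli k lam n =
      (\<Sum>m=0..n. 1 / of_nat (m + 1) powi k *
        (fact n * fps_nth ((1 - fps_degenerate_power lam (- 1 / lam)) ^ m) n))"
    by (simp add: fully_degenerate_poly_bernoulli_def fps_compose_nth fps_polylog_quotient_def
        sum_distrib_left)
  also have "\<dots> = (\<Sum>m=0..n. \<Sum>l=0..n. f l m)"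
    by (simp only: fact_mult_one_minus_fps_degenerate_power_nth[OF assms] sum_distrib_left f_def
        atMost_atLeast0) (simp add: mult_ac)
  also have "\<dots> = (\<Sum>l=0..n. \<Sum>m=0..n. f l m)"
    by (rule sum.swap)
  \<comment> \<open>The terms with \<open>m > l\<close> vanish because
    \<open>Stirling l m = 0\<close> there.\<close>
  also have "\<dots> = (\<Sum>l=0..n. \<Sum>m=0..l. f l m)"
    by (intro sum.cong refl sum.mono_neutral_right) (auto simp: f_def)
  finally show ?thesis
    by (simp only: f_def)
qed

end
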